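(* For every integer $r\ge 0$, every integer $p>0$, and every $x$ with $|x|<1$, $$\sum_{n=0}^{\infty} n^p\left(\frac{1}{(1-x)^{r+1}}-1-\binom{r+1}{1}x-\binom{r+2}{2}x^2-\dots-\binom{r+n}{n}x^n\right)$$ $$=\frac{1}{r!}\left(\frac{d}{dx}\right)^r\left(\frac{x^r}{(1-x)^2}\,\omega_p\!\left(\frac{x}{1-x}\right)\right)-\frac{1}{(1-x)^{r+1}}\,\omega_{p,r+1}\!\left(\frac{x}{1-x}\right).$$
   Context: $S(n,k)$ denotes the Stirling numbers of the second kind. The geometric polynomials are $\omega_n(x)=\sum_{k=0}^{n}S(n,k)\,k!\,x^k$ for integers $n\ge 0$. The generalized geometric polynomials are $\omega_{n,r+1}(x)=\frac{1}{r!}\sum_{k=0}^{n}S(n,k)\,(k+r)!\,x^k$ for integers $n\ge 0$, $r\ge 0$. Here $x$ is a real or complex number. *)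

theory Defs
  imports "HOL-Combinatorics.Stirling" "HOL-Analysis.Analysis"
begin

definition geom_poly :: "nat \<Rightarrow> 'a::real_normed_field \<Rightarrow> 'a" where
  "geom_poly n x = (\<Sum>k=0..n. of_nat (Stirling n k) * fact k * x ^ k)"

(* The second argument is r, so gen_geom_poly n r is the polynomial with subscripts n, r+1;
   in particular gen_geom_poly n 0 is geom_poly n. *)
definition gen_geom_poly :: "nat \<Rightarrow> nat \<Rightarrow> 'a::real_normed_field \<Rightarrow> 'a" where
  "gen_geom_poly n r x =
     1 / fact r * (\<Sum>k=0..n. of_nat (Stirling n k) * fact (k + r) * x ^ k)"

end

theory Submission
  imports Defs
begin

text \<open>
  Expanding \<open>k ^ p\<close> in falling factorials shows that \<open>\<Sum>k. C(k + r, r) k ^ p x ^ k\<close> equals the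
  last term of the claim. For \<open>r = 0\<close>, a further factor \<open>1 / (1 - y)\<close> turns the coefficients into the
  power sums \<open>\<Sum>i\<le>k. i ^ p\<close>, and \<open>(1 / r!) (d / dy) ^ r\<close> of \<open>y ^ r\<close> times that series inserts
  \<open>C(k + r, r)\<close>. The difference therefore is \<open>\<Sum>k. C(k + r, r) (\<Sum>i<k. i ^ p) x ^ k\<close>,
  which is the left-hand side after summation by parts, because the bracket is the tail of the
  binomial series of \<open>1 / (1 - x) ^ (r + 1)\<close>.
\<close>

section \<open>Power series: absolute convergence, partial sums, derivatives\<close>

lemma powser_norm_summable:
  fixes c :: "nat \<Rightarrow> 'a::{real_normed_field,banach}"
  assumes "\<And>z. norm z < K \<Longrightarrow> summable (\<lambda>n. c n * z ^ n)" and "norm z < K"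
  shows "summable (\<lambda>n. norm (c n * z ^ n))"
proof -
  obtain L where L: "norm z < L" "L < K"
    using assms(2) dense by blast
  have "0 < L"
    using L(1) norm_ge_zero[of z] by linarith
  show ?thesis
    \<comment> \<open>Convergence at a point of larger norm forces absolute convergence at
      \<open>z\<close>; positivity of \<open>L\<close> makes
      \<open>norm (of_real L) = L\<close>.\<close>
    by (rule powser_insidea[where x = "of_real L"]) (use L \<open>0 < L\<close> assms(1) in auto)
qed

text \<open>Cauchy product with the geometric series: every coefficient of the second factor is
  1.\<close>

lemma powser_partial_sums:
  fixes c :: "nat \<Rightarrow> 'a::{real_normed_field,banach}"
  assumes sums: "\<And>z. norm z < 1 \<Longrightarrow> (\<lambda>n. c n * z ^ n) sums f z" and z: "norm z < 1"
  shows "(\<lambda>n. (\<Sum>i\<le>n. c i) * z ^ n) sums (f z / (1 - z))"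
proof -
  have 1: "summable (\<lambda>n. norm (c n * z ^ n))"
    by (rule powser_norm_summable[where K = 1]) (use sums z sums_summable in blast)+
  have 2: "summable (\<lambda>n. norm (z ^ n))"
    using z by (simp add: norm_power summable_geometric)
  have "(\<lambda>n. \<Sum>i\<le>n. c i * z ^ i * z ^ (n - i)) sums ((\<Sum>n. c n * z ^ n) * (\<Sum>n. z ^ n))"
    by (rule Cauchy_product_sums[OF 1 2])
  also have "(\<lambda>n. \<Sum>i\<le>n. c i * z ^ i * z ^ (n - i)) = (\<lambda>n. (\<Sum>i\<le>n. c i) * z ^ n)"
    by (auto simp: sum_distrib_right mult.assoc simp flip: power_add intro!: sum.cong)
  also have "(\<Sum>n. c n * z ^ n) * (\<Sum>n. z ^ n) = f z / (1 - z)"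
    using sums_unique[OF sums[OF z]] suminf_geometric[OF z] by simp
  finally show ?thesis .
qed

lemma powser_higher_deriv:
  fixes f :: "'a::{real_normed_field,banach} \<Rightarrow> 'a"
  assumes sums: "\<And>z. norm z < K \<Longrightarrow> (\<lambda>n. c n * z ^ n) sums f z" and "norm z < K"
  shows "(\<lambda>n. (diffs ^^ r) c n * z ^ n) sums (deriv ^^ r) f z"
  using assms(2)
proof (induction r arbitrary: z)
  case 0
  then show ?case using sums by simp
next
  case (Suc r)
  let ?g = "(deriv ^^ r) f" and ?d = "(diffs ^^ r) c"
  have summ: "summable (\<lambda>n. ?d n * w ^ n)" if "norm w < K" for w
    using Suc.IH[OF that] by (rule sums_summable)
  have "((\<lambda>w. \<Sum>n. ?d n * w ^ n) has_field_derivative (\<Sum>n. diffs ?d n * z ^ n)) (at z)"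
    by (rule termdiffs_strong'[OF summ Suc.prems])
  \<comment> \<open>The series is known to equal \<open>?g\<close> only inside the ball, so the
    derivative is transferred on that open set.\<close>
  then have D: "(?g has_field_derivative (\<Sum>n. diffs ?d n * z ^ n)) (at z)"
  proof (rule has_field_derivative_transform_within_open)
    show "open (ball 0 K)" "z \<in> ball 0 K"
      using Suc.prems by auto
    show "(\<Sum>n. ?d n * w ^ n) = ?g w" if "w \<in> ball 0 K" for w
      using that Suc.IH[of w] by (simp add: sums_iff)
  qed
  have "(\<lambda>n. diffs ?d n * z ^ n) sums (\<Sum>n. diffs ?d n * z ^ n)"
    by (rule termdiffs_sums_strong[OF Suc.IH D Suc.prems])
  then show ?case
    using DERIV_imp_deriv[OF D] by simp
qed

lemma funpow_diffs:
  fixes c :: "nat \<Rightarrow> 'a::field_char_0"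
  shows "(diffs ^^ r) c n = fact (n + r) / fact n * c (n + r)"
proof (induction r arbitrary: n)
  case (Suc r)
  have "of_nat (Suc n) * (fact (Suc n + r) / fact (Suc n) * c (Suc n + r))
      = fact (n + Suc r) / fact n * c (n + Suc r)"
    using of_nat_neq_0[of n, where 'a = 'a] by (simp add: fact_Suc[of n] del: of_nat_Suc fact_Suc)
  then show ?case
    using Suc.IH[of "Suc n"] by (simp only: funpow.simps o_apply diffs_def[of "(diffs ^^ r) c"])
qed simp

section \<open>Binomial series\<close>

lemma binomial_series_sums:
  fixes z :: "'a::{real_normed_field,banach}"
  assumes "norm z < 1"
  shows "(\<lambda>n. of_nat ((n + m) choose m) * z ^ n) sums (1 / (1 - z) ^ (m + 1))"
  using assms
proof (induction m arbitrary: z)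
  case 0
  then show ?case by (simp add: geometric_sums)
next
  case (Suc m)
  \<comment> \<open>The hockey-stick identity: one more factor \<open>1 / (1 - z)\<close> raises
    \<open>m\<close> by one.\<close>
  have "(\<Sum>i\<le>n. (i + m) choose m) = (n + Suc m) choose Suc m" for n
    using choose_rising_sum(1)[of m n] by (simp add: add.commute)
  then have *: "(\<Sum>i\<le>n. of_nat ((i + m) choose m)) = (of_nat ((n + Suc m) choose Suc m) :: 'a)" for n
    by (simp flip: of_nat_sum)
  show ?case
    using powser_partial_sums[OF Suc.IH Suc.prems] unfolding * by (simp add: mult.commute)
qed

lemma shifted_binomial_series_sums:
  fixes z :: "'a::{real_normed_field,banach}"
  assumes "norm z < 1"
  shows "(\<lambda>k. of_nat ((k + r) choose (r + j)) * z ^ k) sums (z ^ j / (1 - z) ^ (r + j + 1))"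
proof -
  have "(\<lambda>k. z ^ j * (of_nat ((k + (r + j)) choose (r + j)) * z ^ k))
          sums (z ^ j * (1 / (1 - z) ^ (r + j + 1)))"
    by (intro sums_mult binomial_series_sums assms)
  then have "(\<lambda>k. of_nat ((k + j + r) choose (r + j)) * z ^ (k + j)) sums (z ^ j / (1 - z) ^ (r + j + 1))"
    by (simp add: algebra_simps power_add)
  then show ?thesis
    \<comment> \<open>For \<open>k < j\<close> the coefficient vanishes because
      \<open>k + r < r + j\<close>, so the index shift loses no terms.\<close>
    by (subst (asm) sums_zero_iff_shift) (auto simp: binomial_eq_0)
qed

section \<open>Stirling expansion and generating functions\<close>

text \<open>Here \<open>fact j * (k choose j)\<close> is the falling factorial k(k-1)...(k-j+1).
  Multiplying it by \<open>k = j + (k - j)\<close> reproduces the Stirling recurrence.\<close>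

lemma power_eq_sum_Stirling: "k ^ p = (\<Sum>j\<le>p. Stirling p j * (fact j * (k choose j)))"
proof (induction p)
  case (Suc p)
  have k: "k * (fact j * (k choose j)) = j * (fact j * (k choose j)) + fact (Suc j) * (k choose Suc j)" for j
  proof (cases "j \<le> k")
    case True
    have "Suc j * (k choose Suc j) = (k - j) * (k choose j)"
      using binomial_absorb_comp[of k j] binomial_absorption[of j k] by simp
    then have "fact (Suc j) * (k choose Suc j) = fact j * ((k - j) * (k choose j))"
      by (simp only: fact_Suc mult.assoc of_nat_id mult.left_commute[of _ "fact j"])
    moreover have "k * (fact j * (k choose j)) = (j + (k - j)) * (fact j * (k choose j))"
      using True by simp
    ultimately show ?thesis
      by (simp only: distrib_right distrib_left mult.left_commute[of _ "fact j"])
  qed (simp add: binomial_eq_0)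
  let ?t = "\<lambda>j. fact j * (k choose j)"
  have "(\<Sum>j\<le>Suc p. Stirling (Suc p) j * ?t j)
      = (\<Sum>j\<le>p. Suc j * Stirling p (Suc j) * ?t (Suc j)) + (\<Sum>j\<le>p. Stirling p j * ?t (Suc j))"
    by (subst sum.atMost_Suc_shift) (simp add: distrib_right sum.distrib del: fact_Suc)
  \<comment> \<open>The reindexing is free: the new term \<open>j = 0\<close> carries the factor 0,
    and afterwards \<open>Stirling p (Suc p) = 0\<close> removes the top term.\<close>
  also have "(\<Sum>j\<le>p. Suc j * Stirling p (Suc j) * ?t (Suc j)) = (\<Sum>j\<le>Suc p. j * Stirling p j * ?t j)"
    by (subst sum.atMost_Suc_shift) simp
  also have "\<dots> = (\<Sum>j\<le>p. j * Stirling p j * ?t j)"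
    by simp
  also have "\<dots> + (\<Sum>j\<le>p. Stirling p j * ?t (Suc j)) = (\<Sum>j\<le>p. Stirling p j * (k * ?t j))"
    unfolding k by (simp add: sum.distrib[symmetric] algebra_simps del: fact_Suc)
  also have "\<dots> = k * k ^ p"
    unfolding Suc.IH sum_distrib_left by (simp add: mult.left_commute)
  finally show ?case by simp
qed simp

text \<open>Trinomial revision, with both sides 0 when \<open>j > k\<close>. It merges the weight
  \<open>(k + r) choose r\<close> and a falling factorial into one binomial coefficient, whose
  series is known.\<close>

lemma choose_times_falling:
  "fact r * (((k + r) choose r) * (fact j * (k choose j))) = fact (j + r) * ((k + r) choose (r + j))"
proof (cases "j \<le> k")
  case True
  then have choose: "((k + r) choose (r + j)) * ((r + j) choose r) = ((k + r) choose r) * (k choose j)"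
    using choose_mult[of r "r + j" "k + r"] by simp
  have "fact (j + r) = fact r * fact j * ((r + j) choose r)"
    using binomial_fact_lemma[of r "r + j"] by (simp add: add.commute)
  then have "fact (j + r) * ((k + r) choose (r + j))
      = fact r * fact j * (((k + r) choose (r + j)) * ((r + j) choose r))"
    by (simp only: mult_ac)
  then show ?thesis
    unfolding choose by (simp only: mult_ac)
qed (simp add: binomial_eq_0)

text \<open>The Stirling expansion makes the coefficient a finite combination of
  \<open>(k + r) choose (r + j)\<close>. Taking \<open>1 / (1 - z) ^ (r + 1)\<close> out of the
  closed forms leaves the powers of \<open>z / (1 - z)\<close>.\<close>

lemma gen_geom_poly_sums:
  fixes z :: "'a::{real_normed_field,banach}"
  assumes "norm z < 1"
  shows "(\<lambda>k. of_nat (((k + r) choose r) * k ^ p) * z ^ k)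
           sums (1 / (1 - z) ^ (r + 1) * gen_geom_poly p r (z / (1 - z)))"
proof -
  let ?c = "\<lambda>j. of_nat (Stirling p j) * fact (j + r) / fact r :: 'a"
  have coeff: "of_nat (((k + r) choose r) * (fact j * (k choose j)))
      = (fact (j + r) / fact r * of_nat ((k + r) choose (r + j)) :: 'a)" for k j
    using arg_cong[OF choose_times_falling[of r k j], of "of_nat :: nat \<Rightarrow> 'a"]
    by (simp add: field_simps)
  have *: "of_nat (((k + r) choose r) * k ^ p)
      = (\<Sum>j\<le>p. ?c j * of_nat ((k + r) choose (r + j)))" for k
    unfolding power_eq_sum_Stirling[of k p] sum_distrib_left of_nat_sum
    by (intro sum.cong refl) (simp only: mult.left_commute[of _ "Stirling p j" for j]
          of_nat_mult[of "Stirling p j" for j] coeff times_divide_eq_right times_divide_eq_left mult.assoc)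
  have "(\<lambda>k. \<Sum>j\<le>p. ?c j * (of_nat ((k + r) choose (r + j)) * z ^ k))
          sums (\<Sum>j\<le>p. ?c j * (z ^ j / (1 - z) ^ (r + j + 1)))"
    by (intro sums_sum sums_mult shifted_binomial_series_sums assms)
  also have "(\<lambda>k. \<Sum>j\<le>p. ?c j * (of_nat ((k + r) choose (r + j)) * z ^ k))
      = (\<lambda>k. of_nat (((k + r) choose r) * k ^ p) * z ^ k)"
    unfolding * sum_distrib_right by (simp add: mult.assoc)
  also have "(\<Sum>j\<le>p. ?c j * (z ^ j / (1 - z) ^ (r + j + 1)))
      = 1 / (1 - z) ^ (r + 1) * gen_geom_poly p r (z / (1 - z))"
    unfolding gen_geom_poly_def sum_distrib_left atLeast0AtMost
    by (intro sum.cong refl) (simp add: power_add power_divide)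
  finally show ?thesis .
qed

section \<open>Summation by parts\<close>

lemma weighted_tails_sums:
  fixes b :: "nat \<Rightarrow> 'a::{real_normed_field,banach}" and a :: "nat \<Rightarrow> nat"
  assumes b: "b sums B"
    and s: "(\<lambda>k. of_nat (\<Sum>i<k. a i) * b k) sums s"
    and abs: "summable (\<lambda>k. norm (of_nat (\<Sum>i<k. a i) * b k))"
  shows "(\<lambda>n. of_nat (a n) * (B - (\<Sum>k\<le>n. b k))) sums s"
proof -
  let ?A = "\<lambda>N. \<Sum>i<N. a i"
  let ?g = "\<lambda>k. norm (of_nat (?A k) * b k)"
  have parts: "(\<Sum>n<N. of_nat (a n) * (B - (\<Sum>k\<le>n. b k)))
      = of_nat (?A N) * (B - (\<Sum>k<N. b k)) + (\<Sum>k<N. of_nat (?A k) * b k)" for N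
    by (induction N) (simp_all add: lessThan_Suc_atMost[symmetric] algebra_simps)
  \<comment> \<open>The boundary term is \<open>?A N\<close> times a tail of \<open>b\<close>. Since
    \<open>?A\<close> is nondecreasing, \<open>?A N\<close> may be replaced by
    \<open>?A (k + N)\<close> under the sum, which bounds the term by a tail of a convergent
    series.\<close>
  have bound: "norm (of_nat (?A N) * (B - (\<Sum>k<N. b k))) \<le> (\<Sum>k. ?g (k + N))" for N
  proof -
    have tail: "(\<lambda>k. of_nat (?A N) * b (k + N)) sums (of_nat (?A N) * (B - (\<Sum>k<N. b k)))"
      by (intro sums_mult sums_split_initial_segment b)
    have "norm (\<Sum>k. of_nat (?A N) * b (k + N)) \<le> (\<Sum>k. ?g (k + N))"
    proof (rule norm_suminf_le)
      show "summable (\<lambda>k. ?g (k + N))"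
        by (rule summable_ignore_initial_segment[OF abs])
      have "?A N \<le> ?A (k + N)" for k
        by (rule sum_mono2) auto
      then show "norm (of_nat (?A N) * b (k + N)) \<le> ?g (k + N)" for k
        unfolding norm_mult norm_of_nat by (intro mult_right_mono) (simp_all only: of_nat_le_iff norm_ge_zero)
    qed
    then show ?thesis
      using sums_unique[OF tail] by simp
  qed
  have "(\<lambda>N. suminf ?g - (\<Sum>k<N. ?g k)) \<longlonglongrightarrow> suminf ?g - suminf ?g"
    by (intro tendsto_diff tendsto_const summable_LIMSEQ abs)
  then have "(\<lambda>N. \<Sum>k. ?g (k + N)) \<longlonglongrightarrow> 0"
    by (simp only: suminf_minus_initial_segment[OF abs] diff_self)
  then have "(\<lambda>N. of_nat (?A N) * (B - (\<Sum>k<N. b k))) \<longlonglongrightarrow> 0"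
    by (rule Lim_null_comparison[rotated]) (simp only: bound eventually_sequentially, simp)
  from tendsto_add[OF this s[unfolded sums_def]] show ?thesis
    unfolding sums_def parts by simp
qed

lemma higher_deriv_geom_poly_sums:
  fixes z :: "'a::{real_normed_field,banach}"
  assumes "norm z < 1"
  shows "(\<lambda>k. of_nat (((k + r) choose r) * (\<Sum>i\<le>k. i ^ p)) * z ^ k)
           sums (1 / fact r * (deriv ^^ r) (\<lambda>y. y ^ r / (1 - y)\<^sup>2 * geom_poly p (y / (1 - y))) z)"
proof -
  let ?F = "\<lambda>y::'a. y ^ r / (1 - y)\<^sup>2 * geom_poly p (y / (1 - y))"
  define S :: "nat \<Rightarrow> 'a" where "S = (\<lambda>n. \<Sum>i\<le>n. of_nat (i ^ p))"
  \<comment> \<open>Coefficients of \<open>?F\<close>: the factor \<open>y ^ r\<close> moves the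
    power sums \<open>S\<close> up by \<open>r\<close> places.\<close>
  define c where "c = (\<lambda>n. if n < r then 0 else S (n - r))"
  have geom: "gen_geom_poly p 0 = (geom_poly p :: 'a \<Rightarrow> 'a)"
    by (auto simp: gen_geom_poly_def geom_poly_def)
  have pw: "(\<lambda>k. of_nat (k ^ p) * y ^ k) sums (1 / (1 - y) * geom_poly p (y / (1 - y)))"
    if "norm y < 1" for y :: 'a
    using gen_geom_poly_sums[OF that, of 0 p] by (simp add: geom)
  have F: "(\<lambda>n. c n * y ^ n) sums ?F y" if y: "norm y < 1" for y
  proof -
    have "(\<lambda>n. y ^ r * (S n * y ^ n)) sums (y ^ r * (1 / (1 - y) * geom_poly p (y / (1 - y)) / (1 - y)))"
      unfolding S_def by (intro sums_mult powser_partial_sums[OF pw y])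
    also have "(\<lambda>n. y ^ r * (S n * y ^ n)) = (\<lambda>n. c (n + r) * y ^ (n + r))"
      by (simp add: c_def power_add mult_ac)
    also have "y ^ r * (1 / (1 - y) * geom_poly p (y / (1 - y)) / (1 - y)) = ?F y"
      by (simp add: power2_eq_square)
    finally show ?thesis
      by (subst (asm) sums_zero_iff_shift) (auto simp: c_def)
  qed
  have "(\<lambda>n. 1 / fact r * ((diffs ^^ r) c n * z ^ n)) sums (1 / fact r * (deriv ^^ r) ?F z)"
    by (intro sums_mult powser_higher_deriv[OF F assms])
  \<comment> \<open>The \<open>r\<close> derivatives undo the shift, as
    \<open>c (n + r) = S n\<close>, and the factor \<open>fact (n + r) / (fact n * fact r)\<close>
    is the binomial coefficient.\<close>
  moreover have "1 / fact r * ((diffs ^^ r) c n * z ^ n)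
      = of_nat (((n + r) choose r) * (\<Sum>i\<le>n. i ^ p)) * z ^ n" for n
    using binomial_fact[of r "n + r", where 'a = 'a]
    by (simp add: funpow_diffs c_def S_def)
  ultimately show ?thesis by simp
qed

theorem corollary4:
  fixes x :: "'a::{real_normed_field,banach}" and r p :: nat
  assumes "p > 0" and "norm x < 1"
  shows "(\<lambda>n. of_nat n ^ p *
            (1 / (1 - x) ^ (r + 1) - 1 - (\<Sum>k=1..n. of_nat ((r + k) choose k) * x ^ k)))
         sums
         (1 / fact r * (deriv ^^ r) (\<lambda>y. y ^ r / (1 - y)\<^sup>2 * geom_poly p (y / (1 - y))) x
          - 1 / (1 - x) ^ (r + 1) * gen_geom_poly p r (x / (1 - x)))"
proof -
  define b where "b = (\<lambda>k. of_nat ((k + r) choose r) * x ^ k)"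
  let ?rhs = "\<lambda>z::'a. 1 / fact r * (deriv ^^ r) (\<lambda>y. y ^ r / (1 - y)\<^sup>2 * geom_poly p (y / (1 - y))) z
          - 1 / (1 - z) ^ (r + 1) * gen_geom_poly p r (z / (1 - z))"
  let ?d = "\<lambda>k. of_nat (((k + r) choose r) * (\<Sum>i<k. i ^ p)) :: 'a"
  have "(\<lambda>k. of_nat (((k + r) choose r) * (\<Sum>i\<le>k. i ^ p)) * z ^ k
           - of_nat (((k + r) choose r) * k ^ p) * z ^ k) sums ?rhs z" if "norm z < 1" for z
    by (intro sums_diff higher_deriv_geom_poly_sums gen_geom_poly_sums that)
  \<comment> \<open>Subtracting \<open>k ^ p\<close> drops the last term of the power sum, giving
    the strict range \<open>i < k\<close> that summation by parts produces.\<close>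
  moreover have "of_nat (((k + r) choose r) * (\<Sum>i\<le>k. i ^ p)) * z ^ k
           - of_nat (((k + r) choose r) * k ^ p) * z ^ k = ?d k * z ^ k" for k z
    by (simp add: lessThan_Suc_atMost[symmetric] algebra_simps)
  \<comment> \<open>Stated on the whole disc, since absolute convergence at \<open>x\<close> is
    drawn from convergence at points of larger norm.\<close>
  ultimately have d: "(\<lambda>k. ?d k * z ^ k) sums ?rhs z" if "norm z < 1" for z
    using that by simp
  have db: "?d k * x ^ k = of_nat (\<Sum>i<k. i ^ p) * b k" for k
    by (simp add: b_def mult_ac)
  have "summable (\<lambda>k. norm (?d k * x ^ k))"
    by (rule powser_norm_summable[where K = 1]) (use d assms(2) sums_summable in blast)+
  then have "(\<lambda>n. of_nat (n ^ p) * (1 / (1 - x) ^ (r + 1) - (\<Sum>k\<le>n. b k))) sums ?rhs x"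
    using binomial_series_sums[OF assms(2), of r] d[OF assms(2)]
    unfolding db by (intro weighted_tails_sums) (simp_all add: b_def)
  \<comment> \<open>The separate 1 in the claim is the term \<open>k = 0\<close>; symmetry turns
    \<open>choose r\<close> into \<open>choose k\<close>.\<close>
  moreover have "(\<Sum>k\<le>n. b k) = 1 + (\<Sum>k=1..n. of_nat ((r + k) choose k) * x ^ k)" for n
  proof -
    have "b k = of_nat ((r + k) choose k) * x ^ k" for k
      using binomial_symmetric[of r "k + r"] by (simp add: b_def add.commute)
    then show ?thesis
      by (simp add: atMost_atLeast0 sum.atLeast_Suc_atMost)
  qed
  ultimately show ?thesis
    by (simp add: diff_diff_eq)
qed

end
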